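(* Let $\ell_1,\ell_2,N$ be positive integers with $\ell_1+\ell_2\ge N$ and assume $\ell_2\le N$. Let $D:=\ell_1\wedge N+\ell_2\wedge N-N$. Let $m\in\{0,1,\ldots,N-\ell_2-1\}$ and $n=D+m+1$. Then, as polynomials in $x$, $$\mathsf Q_n(x;\ell_1,\ell_2,N)=\frac{(-N+\ell_2+1)_m}{(-(\ell_1\wedge N))_n}\;\prod_{j=N-\ell_2}^{\ell_1\wedge N}(x-j)\;\cdot\;\mathsf Q_m\big(x;\,N-\ell_2-1,\,|N-\ell_1|-1,\,\ell_1\vee N\big).$$ In particular, if $D<n\le \ell_1\wedge N$, then $\mathsf Q_n(x;\ell_1,\ell_2,N)=0$ for every $x\in V_{\ell,N}=\{x\in\mathbb N_0:\ N-\ell_2\wedge N\le x\le \ell_1\wedge N\}$.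
   Context: Notation: $a\wedge b=\min\{a,b\}$, $a\vee b=\max\{a,b\}$; $(a)_k=a(a+1)\cdots(a+k-1)$, $(a)_0=1$, is the Pochhammer symbol; $\mathbb N_0=\{0,1,2,\ldots\}$. Hahn polynomials with negative integer parameters are defined by the terminating hypergeometric sum $$\mathsf Q_n(x;a,b,M)={}_3F_2\left(\begin{matrix}-n,\ n-a-b-1,\ -x\\ -a,\ -M\end{matrix};1\right)=\sum_{k=0}^n\frac{(-n)_k(n-a-b-1)_k(-x)_k}{(-a)_k(-M)_k\,k!},$$ for integers $a,b,M$ and $0\le n\le a\wedge M$ (so that the denominators do not vanish). The same formula is used for the polynomial $\mathsf Q_m$ on the right-hand side of the claim. *)

theory Defs
  imports Complex_Main "HOL-Computational_Algebra.Polynomial"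
begin

text \<open>
  The Hahn polynomial $Q_n(x; a, b, M)$ as a polynomial in the indeterminate $x$: here
  \<^term>\<open>[:0, -1:]\<close> is $-x$, so its Pochhammer symbol is $(-x)_k$.
  The definition is meaningful for \<open>n \<le> min a M\<close>; for larger \<open>n\<close> the denominators may vanish, and
  the corresponding summands are then \<open>0\<close> by the convention for division.
\<close>

definition hahn_poly :: "nat \<Rightarrow> int \<Rightarrow> int \<Rightarrow> int \<Rightarrow> real poly" where
  "hahn_poly n a b M =
     (\<Sum>k=0..n. smult
        (pochhammer (- of_nat n) k * pochhammer (of_int (int n - a - b - 1)) k /
          (pochhammer (- of_int a) k * pochhammer (- of_int M) k * fact k))
        (pochhammer [:0, -1:] k))"

definition V_set :: "int \<Rightarrow> int \<Rightarrow> int \<Rightarrow> nat set" where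
  "V_set l1 l2 N = {x. N - min l2 N \<le> int x \<and> int x \<le> min l1 N}"

end

theory Submission imports Defs begin

text \<open>
  By the Chu--Vandermonde identity, a terminating sum \<open>3F2(-n, e + p, y; d, e; 1)\<close>, multiplied by
  \<open>(d)_n\<close>, equals \<open>\<Sum>i. C(n,i) (-p)_i (y)_i (d - y)_{n-i} / (e)_i\<close>. Write \<open>L\<close> and \<open>U\<close> for the minimum and
  the maximum of \<open>l1\<close> and \<open>N\<close>, and \<open>c = N - l2 - 1\<close>. Both Hahn polynomials in the claim have this shape
  with \<open>e = -U\<close> and \<open>y = -x\<close>: the left one with \<open>(p, d) = (m, -L)\<close>, the right one with the
  roles of \<open>m\<close> and \<open>n\<close> exchanged and \<open>d = -c\<close>. Since \<open>C(n,i) (-m)_i\<close> is symmetric in \<open>m\<close> and \<open>n\<close>, the two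
  sums agree up to the factor \<open>(x - L)_{L-c}\<close>, which is the product over \<open>j\<close>.
\<close>

text \<open>Reversing the factors of \<open>(d + s)_{n-s}\<close> turns it into
  \<open>(1 - d - n)_{n-s}\<close> with sign \<open>(-1)^(n-s)\<close>. All signs then combine to
  \<open>(-1)^n\<close>, the binomial theorem for rising factorials applies, and a second reversal
  absorbs that sign.\<close>

lemma chu_vandermonde_pochhammer:
  fixes y d :: "'a::field_char_0"
  shows "(\<Sum>s\<le>n. (-1) ^ s * of_nat (n choose s) * pochhammer y s *
            pochhammer (d + of_nat s) (n - s)) = pochhammer (d - y) n"
proof -
  have refl: "pochhammer (d + of_nat s) (n - s) =
      (-1) ^ (n - s) * pochhammer (1 - d - of_nat n) (n - s)" if "s \<le> n" for s
    using that pochhammer_minus[of "d + of_nat n - 1" "n - s"]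
    by (simp add: of_nat_diff algebra_simps flip: power_add mult_2)
  have "(\<Sum>s\<le>n. (-1) ^ s * of_nat (n choose s) * pochhammer y s *
            pochhammer (d + of_nat s) (n - s)) =
        (\<Sum>s\<le>n. (-1) ^ n * (of_nat (n choose s) * pochhammer y s *
            pochhammer (1 - d - of_nat n) (n - s)))"
    by (intro sum.cong refl) (simp_all add: refl flip: power_add)
  also have "\<dots> = (-1) ^ n * pochhammer (y + (1 - d - of_nat n)) n"
    by (simp only: pochhammer_binomial_sum sum_distrib_left)
  also have "\<dots> = pochhammer (d - y) n"
    using pochhammer_minus[of "y - d" n] by (simp add: algebra_simps)
  finally show ?thesis .
qed

text \<open>Since \<open>C(n,k) C(k,j) = C(n,j) C(n-j,k-j)\<close>, the shift
  \<open>k = s + j\<close> leaves the previous sum for \<open>n - j\<close>, \<open>y + j\<close>,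
  \<open>d + j\<close>; the difference \<open>d - y\<close> is unchanged.\<close>

lemma chu_vandermonde_choose:
  fixes y d :: "'a::field_char_0"
  assumes "j \<le> n"
  shows "(\<Sum>k\<le>n. (-1) ^ k * of_nat (n choose k) * of_nat (k choose j) * pochhammer y k *
            pochhammer (d + of_nat k) (n - k)) =
         (-1) ^ j * of_nat (n choose j) * pochhammer y j * pochhammer (d - y) (n - j)"
    (is "sum ?f _ = _")
proof -
  have "sum ?f {..n} = sum ?f {j..n}"
    by (rule sum.mono_neutral_right) (auto simp: binomial_eq_0)
  also have "\<dots> = (\<Sum>s\<le>n - j. ?f (s + j))"
    using assms by (intro sum.reindex_bij_witness[of _ "\<lambda>s. s + j" "\<lambda>k. k - j"]) auto
  also have "\<dots> = (\<Sum>s\<le>n - j. (-1) ^ j * of_nat (n choose j) * pochhammer y j *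
      ((-1) ^ s * of_nat ((n - j) choose s) * pochhammer (y + of_nat j) s *
       pochhammer (d + of_nat j + of_nat s) (n - j - s)))"
  proof (rule sum.cong)
    fix s assume "s \<in> {..n - j}"
    with assms have s: "s + j \<le> n" by auto
    have "(n choose (s + j)) * ((s + j) choose j) = (n choose j) * ((n - j) choose s)"
      using choose_mult[of j "s + j" n] s by simp
    hence "of_nat (n choose (s + j)) * of_nat ((s + j) choose j) =
           (of_nat (n choose j) * of_nat ((n - j) choose s) :: 'a)"
      by (metis of_nat_mult)
    moreover have "pochhammer y (s + j) = pochhammer y j * pochhammer (y + of_nat j) s"
      by (simp add: pochhammer_product' add.commute)
    moreover have "n - (s + j) = n - j - s" "d + of_nat (s + j) = d + of_nat j + of_nat s"
      by simp_all
    ultimately show "?f (s + j) = (-1) ^ j * of_nat (n choose j) * pochhammer y j *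
      ((-1) ^ s * of_nat ((n - j) choose s) * pochhammer (y + of_nat j) s *
       pochhammer (d + of_nat j + of_nat s) (n - j - s))"
      by (simp add: power_add ac_simps)
  qed simp
  also have "\<dots> = (-1) ^ j * of_nat (n choose j) * pochhammer y j * pochhammer (d - y) (n - j)"
    using chu_vandermonde_pochhammer[of "n - j" "y + of_nat j" "d + of_nat j"]
    by (simp add: sum_distrib_left [symmetric])
  finally show ?thesis .
qed

text \<open>This is Chu-Vandermonde with \<open>y = -p\<close>, \<open>d = e\<close>, divided by
  \<open>(e)_k = (e)_i (e+i)_{k-i}\<close>. Summing up to \<open>n\<close> only adds zero terms and
  makes the range independent of \<open>k\<close>, so that the sums can be interchanged
  later.\<close>

lemma pochhammer_ratio_sum:
  fixes e p :: "'a::field_char_0"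
  assumes "pochhammer e k \<noteq> 0" "k \<le> n"
  shows "pochhammer (e + p) k / pochhammer e k =
         (\<Sum>i\<le>n. (-1) ^ i * of_nat (k choose i) * pochhammer (- p) i / pochhammer e i)"
proof -
  have "(\<Sum>i\<le>n. (-1) ^ i * of_nat (k choose i) * pochhammer (- p) i / pochhammer e i) =
        (\<Sum>i\<le>k. (-1) ^ i * of_nat (k choose i) * pochhammer (- p) i / pochhammer e i)"
    using assms by (intro sum.mono_neutral_right) (auto simp: binomial_eq_0)
  also have "\<dots> = (\<Sum>i\<le>k. (-1) ^ i * of_nat (k choose i) * pochhammer (- p) i *
                     pochhammer (e + of_nat i) (k - i)) / pochhammer e k"
    unfolding sum_divide_distrib
  proof (rule sum.cong)
    fix i assume "i \<in> {..k}"
    hence "pochhammer e k = pochhammer e i * pochhammer (e + of_nat i) (k - i)"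
      by (simp add: pochhammer_product)
    thus "(-1) ^ i * of_nat (k choose i) * pochhammer (- p) i / pochhammer e i =
          (-1) ^ i * of_nat (k choose i) * pochhammer (- p) i *
            pochhammer (e + of_nat i) (k - i) / pochhammer e k"
      using assms by (auto simp: field_simps)
  qed simp
  also have "\<dots> = pochhammer (e + p) k / pochhammer e k"
    by (simp add: chu_vandermonde_pochhammer)
  finally show ?thesis ..
qed

text \<open>This form shows both the vanishing for \<open>k > n\<close> and the symmetry of
  \<open>C(n,i) (-m)_i\<close> in \<open>m\<close> and \<open>n\<close>.\<close>

lemma pochhammer_minus_of_nat:
  "pochhammer (- of_nat n :: 'a::field_char_0) k = (-1) ^ k * fact k * of_nat (n choose k)"
  by (simp add: binomial_gbinomial gbinomial_pochhammer flip: power_add mult_2)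

text \<open>Expanding \<open>(e+p)_k / (e)_k\<close> over \<open>i\<close> and interchanging the
  sums leaves an inner sum over \<open>k\<close> that \<open>chu_vandermonde_choose\<close>
  evaluates.\<close>

lemma hypergeom_3F2_transform:
  fixes d e p y :: "'a::field_char_0"
  assumes d: "pochhammer d n \<noteq> 0" and e: "pochhammer e n \<noteq> 0"
  shows "pochhammer d n *
           (\<Sum>k\<le>n. pochhammer (- of_nat n) k * pochhammer (e + p) k * pochhammer y k /
                    (pochhammer d k * pochhammer e k * fact k)) =
         (\<Sum>i\<le>n. of_nat (n choose i) * pochhammer (- p) i * pochhammer y i *
                  pochhammer (d - y) (n - i) / pochhammer e i)"
proof -
  have "pochhammer d n *
           (\<Sum>k\<le>n. pochhammer (- of_nat n) k * pochhammer (e + p) k * pochhammer y k /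
                    (pochhammer d k * pochhammer e k * fact k)) =
        (\<Sum>k\<le>n. (-1) ^ k * of_nat (n choose k) * pochhammer y k *
            pochhammer (d + of_nat k) (n - k) * (pochhammer (e + p) k / pochhammer e k))"
    unfolding sum_distrib_left
  proof (rule sum.cong)
    fix k assume k: "k \<in> {..n}"
    \<comment> \<open>The factor \<open>(d)_n\<close> clears \<open>(d)_k\<close>, and
      \<open>(-n)_k / k!\<close> is a signed binomial coefficient.\<close>
    hence "pochhammer d n = pochhammer d k * pochhammer (d + of_nat k) (n - k)"
      by (simp add: pochhammer_product)
    with d show "pochhammer d n * (pochhammer (- of_nat n) k * pochhammer (e + p) k *
          pochhammer y k / (pochhammer d k * pochhammer e k * fact k)) =
        (-1) ^ k * of_nat (n choose k) * pochhammer y k *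
          pochhammer (d + of_nat k) (n - k) * (pochhammer (e + p) k / pochhammer e k)"
      by (simp add: pochhammer_minus_of_nat)
  qed simp
  also have "\<dots> = (\<Sum>k\<le>n. \<Sum>i\<le>n. (-1) ^ i * pochhammer (- p) i / pochhammer e i *
      ((-1) ^ k * of_nat (n choose k) * of_nat (k choose i) * pochhammer y k *
       pochhammer (d + of_nat k) (n - k)))"
    using e by (intro sum.cong)
      (auto simp: pochhammer_ratio_sum[where n = n] pochhammer_neq_0_mono sum_distrib_left
            intro!: sum.cong)
  also have "\<dots> = (\<Sum>i\<le>n. (-1) ^ i * pochhammer (- p) i / pochhammer e i *
      (\<Sum>k\<le>n. (-1) ^ k * of_nat (n choose k) * of_nat (k choose i) * pochhammer y k *
       pochhammer (d + of_nat k) (n - k)))"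
    by (subst sum.swap) (simp add: sum_distrib_left)
  also have "\<dots> = (\<Sum>i\<le>n. of_nat (n choose i) * pochhammer (- p) i * pochhammer y i *
                  pochhammer (d - y) (n - i) / pochhammer e i)"
    by (intro sum.cong) (simp_all add: chu_vandermonde_choose flip: power_add mult_2)
  finally show ?thesis .
qed

lemma pochhammer_minus_of_nat_neq_0:
  "k \<le> n \<Longrightarrow> pochhammer (- of_nat n :: 'a::field_char_0) k \<noteq> 0"
  by (simp add: pochhammer_minus_of_nat)

text \<open>The hypotheses give \<open>n \<le> L \<le> U\<close> and
  \<open>m \<le> c \<le> U\<close>, so no denominator vanishes and both sides can be transformed,
  the left with \<open>p = m\<close> and the right with \<open>p = n\<close>.\<close>

lemma hypergeom_3F2_factor:
  fixes x :: "'a::field_char_0"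
  assumes "m \<le> c" "c \<le> L" "L \<le> U" and n: "n = L - c + m"
  shows "pochhammer (- of_nat L) n *
           (\<Sum>k\<le>n. pochhammer (- of_nat n) k * pochhammer (- of_nat U + of_nat m) k *
               pochhammer (- x) k /
               (pochhammer (- of_nat L) k * pochhammer (- of_nat U) k * fact k)) =
         pochhammer (x - of_nat L) (L - c) * (pochhammer (- of_nat c) m *
           (\<Sum>k\<le>m. pochhammer (- of_nat m) k * pochhammer (- of_nat U + of_nat n) k *
               pochhammer (- x) k /
               (pochhammer (- of_nat c) k * pochhammer (- of_nat U) k * fact k)))"
    (is "?l = _ * ?r")
proof -
  have "?l = (\<Sum>i\<le>n. of_nat (n choose i) * pochhammer (- of_nat m) i * pochhammer (- x) i *
                  pochhammer (- of_nat L - - x) (n - i) / pochhammer (- of_nat U) i)"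
    using assms by (intro hypergeom_3F2_transform pochhammer_minus_of_nat_neq_0) auto
  also have "\<dots> = (\<Sum>i\<le>m. of_nat (n choose i) * pochhammer (- of_nat m) i * pochhammer (- x) i *
                  pochhammer (- of_nat L - - x) (n - i) / pochhammer (- of_nat U) i)"
    \<comment> \<open>Here \<open>m \<le> n\<close>, and \<open>(-m)_i\<close> vanishes for
      \<open>i > m\<close>.\<close>
    using n by (intro sum.mono_neutral_right) (auto simp: pochhammer_minus_of_nat)
  also have "\<dots> = pochhammer (x - of_nat L) (L - c) *
      (\<Sum>i\<le>m. of_nat (m choose i) * pochhammer (- of_nat n) i * pochhammer (- x) i *
                  pochhammer (- of_nat c - - x) (m - i) / pochhammer (- of_nat U) i)"
    unfolding sum_distrib_left
  proof (rule sum.cong)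
    fix i assume "i \<in> {..m}"
    \<comment> \<open>As \<open>n - m = L - c\<close>, the first \<open>L - c\<close> factors of
      \<open>(x - L)_{n-i}\<close> do not depend on \<open>i\<close>; the rest is
      \<open>(x - c)_{m-i}\<close>.\<close>
    hence "n - i = (L - c) + (m - i)" using n by simp
    moreover have "x - of_nat L + of_nat (L - c) = x - of_nat c"
      using assms by (simp add: of_nat_diff)
    ultimately have "pochhammer (x - of_nat L) (n - i) =
        pochhammer (x - of_nat L) (L - c) * pochhammer (x - of_nat c) (m - i)"
      by (metis pochhammer_product')
    thus "of_nat (n choose i) * pochhammer (- of_nat m) i * pochhammer (- x) i *
            pochhammer (- of_nat L - - x) (n - i) / pochhammer (- of_nat U) i =
          pochhammer (x - of_nat L) (L - c) *
            (of_nat (m choose i) * pochhammer (- of_nat n) i * pochhammer (- x) i *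
             pochhammer (- of_nat c - - x) (m - i) / pochhammer (- of_nat U) i)"
      by (simp add: pochhammer_minus_of_nat)
  qed simp
  also have "(\<Sum>i\<le>m. of_nat (m choose i) * pochhammer (- of_nat n) i * pochhammer (- x) i *
                  pochhammer (- of_nat c - - x) (m - i) / pochhammer (- of_nat U) i) = ?r"
    using assms
    by (intro hypergeom_3F2_transform[symmetric] pochhammer_minus_of_nat_neq_0) auto
  finally show ?thesis .
qed

lemma poly_pochhammer: "poly (pochhammer p k) x = pochhammer (poly p x) k"
  by (simp add: pochhammer_prod poly_prod)

lemma poly_hahn_poly:
  "poly (hahn_poly n a b M) x =
     (\<Sum>k\<le>n. pochhammer (- of_nat n) k * pochhammer (of_int (int n - a - b - 1)) k *
        pochhammer (- x) k / (pochhammer (- of_int a) k * pochhammer (- of_int M) k * fact k))"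
  by (simp add: hahn_poly_def poly_sum poly_pochhammer atMost_atLeast0)

lemma prod_linear_eq_pochhammer:
  fixes x :: real
  assumes "c \<le> L"
  shows "(\<Prod>j\<in>{int c + 1..int L}. x - of_int j) = pochhammer (x - of_nat L) (L - c)"
  unfolding pochhammer_prod using assms
  by (intro prod.reindex_bij_witness[of _ "\<lambda>i. int L - int i" "\<lambda>j. nat (int L - j)"]) auto

text \<open>The bound on \<open>m\<close> forces \<open>l2 < N\<close>, so \<open>min l2 N\<close>
  is written as \<open>l2\<close> here.\<close>

lemma hahn_poly_factor:
  fixes l1 l2 N :: int and m n :: nat
  assumes "l1 > 0" "N > 0" "l1 + l2 \<ge> N" "l2 \<ge> 0"
    and m: "int m \<le> N - l2 - 1" and n: "int n = min l1 N + l2 - N + int m + 1"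
  shows "hahn_poly n l1 l2 N =
           smult (pochhammer (of_int (- N + l2 + 1)) m / pochhammer (- of_int (min l1 N)) n)
             ((\<Prod>j\<in>{N - l2..min l1 N}. [:- of_int j, 1:])
               * hahn_poly m (N - l2 - 1) (\<bar>N - l1\<bar> - 1) (max l1 N))"
    (is "_ = ?rhs")
proof -
  define L U c where "L = nat (min l1 N)" and "U = nat (max l1 N)" and "c = nat (N - l2 - 1)"
  have LUc: "int L = min l1 N" "int U = max l1 N" "int c = N - l2 - 1"
    using assms by (auto simp: L_def U_def c_def)
  have le: "m \<le> c" "c \<le> L" "L \<le> U" "n = L - c + m" "n \<le> L"
    using LUc assms by linarith+
  have real_LUc: "real_of_int (min l1 N) = real L" "real_of_int (max l1 N) = real U"
      "real_of_int (N - l2 - 1) = real c" "real_of_int (- N + l2 + 1) = - real c"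
    using LUc by linarith+
  \<comment> \<open>Both upper parameters reduce to \<open>U\<close> by
    \<open>L + U = l1 + N\<close> and \<open>U - L = \<bar>N - l1\<bar>\<close>.\<close>
  have l_param: "real_of_int (int n - l1 - l2 - 1) = - real U + real m"
    using n LUc(2) by linarith
  have r_param: "real_of_int (int m - (N - l2 - 1) - (\<bar>N - l1\<bar> - 1) - 1) = - real U + real n"
    using n LUc(2) by linarith
  \<comment> \<open>The denominator is symmetric in \<open>l1\<close> and \<open>N\<close>, so they
    may be sorted into \<open>L\<close> and \<open>U\<close>.\<close>
  have denom: "pochhammer (- real_of_int l1) k * pochhammer (- real_of_int N) k =
      pochhammer (- real L) k * pochhammer (- real U) k" for k
    using real_LUc(1,2) by (cases "l1 \<le> N") (simp_all add: min_def max_def)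
  \<comment> \<open>Equal values at all reals give equal polynomials.\<close>
  have "poly (hahn_poly n l1 l2 N) x = poly ?rhs x" for x
  proof -
    have "pochhammer (- real L) n * poly (hahn_poly n l1 l2 N) x =
        pochhammer (x - real L) (L - c) *
          (pochhammer (- real c) m * poly (hahn_poly m (N - l2 - 1) (\<bar>N - l1\<bar> - 1) (max l1 N)) x)"
      unfolding poly_hahn_poly l_param r_param denom real_LUc
      using le(1-4) by (rule hypergeom_3F2_factor)
    moreover have "(\<Prod>j\<in>{N - l2..min l1 N}. x - real_of_int j) = pochhammer (x - real L) (L - c)"
      using prod_linear_eq_pochhammer[OF le(2), of x] LUc by simp
    moreover have "pochhammer (- real L) n \<noteq> 0"
      using le(5) by (rule pochhammer_minus_of_nat_neq_0)
    ultimately show ?thesis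
      unfolding real_LUc by (simp add: poly_prod field_simps)
  qed
  thus ?thesis
    by (intro poly_eq_poly_eq_iff[THEN iffD1] ext)
qed

theorem theorem2p4:
  fixes l1 l2 N D :: int
  assumes "l1 > 0" and "l2 > 0" and "N > 0"
    and "l1 + l2 \<ge> N" and "l2 \<le> N"
  defines "D \<equiv> min l1 N + min l2 N - N"
  shows "(\<forall>m n :: nat. int m \<le> N - l2 - 1 \<and> int n = D + int m + 1 \<longrightarrow>
           hahn_poly n l1 l2 N =
             smult (pochhammer (of_int (- N + l2 + 1)) m / pochhammer (- of_int (min l1 N)) n)
               ((\<Prod>j\<in>{N - l2..min l1 N}. [:- of_int j, 1:])
                 * hahn_poly m (N - l2 - 1) (\<bar>N - l1\<bar> - 1) (max l1 N)))
       \<and> (\<forall>n :: nat. D < int n \<and> int n \<le> min l1 N \<longrightarrow>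
           (\<forall>x\<in>V_set l1 l2 N. poly (hahn_poly n l1 l2 N) (of_nat x) = 0))"
proof (intro conjI allI impI ballI)
  fix m n :: nat
  assume "int m \<le> N - l2 - 1 \<and> int n = D + int m + 1"
  thus "hahn_poly n l1 l2 N =
             smult (pochhammer (of_int (- N + l2 + 1)) m / pochhammer (- of_int (min l1 N)) n)
               ((\<Prod>j\<in>{N - l2..min l1 N}. [:- of_int j, 1:])
                 * hahn_poly m (N - l2 - 1) (\<bar>N - l1\<bar> - 1) (max l1 N))"
    using assms by (intro hahn_poly_factor) auto
next
  fix n x :: nat
  assume n: "D < int n \<and> int n \<le> min l1 N" and x: "x \<in> V_set l1 l2 N"
  \<comment> \<open>Here \<open>D < n\<close> makes \<open>m\<close> nonnegative, and
    \<open>n \<le> min l1 N\<close> becomes \<open>m \<le> N - l2 - 1\<close>.\<close>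
  define m where "m = nat (int n - D - 1)"
  have "int m \<le> N - l2 - 1" "int n = min l1 N + l2 - N + int m + 1"
    using n assms by (auto simp: m_def)
  note factor = hahn_poly_factor[OF assms(1,3,4) _ this]
  \<comment> \<open>\<open>V_set\<close> is exactly the index range of the product, so the factor
    with \<open>j = x\<close> vanishes.\<close>
  have "int x \<in> {N - l2..min l1 N}"
    using x assms(5) by (auto simp: V_set_def)
  hence "(\<Prod>j\<in>{N - l2..min l1 N}. real x - real_of_int j) = 0"
    by (intro prod_zero) (auto intro!: bexI[of _ "int x"])
  thus "poly (hahn_poly n l1 l2 N) (of_nat x) = 0"
    using assms(2) by (simp add: factor poly_prod)
qed

end
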